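(* For integers $m\ge n\ge0$ let $\lambda=\sqrt{(n+m)^2+n+m}$ and $s=m-n\ge0$. If $m=m(n)$ is such that $\dfrac{s}{\lambda}\to0$ as $n\to\infty$, then for real $x$ $$P_{2n}^{(m-n)}(x)=(-1)^n\,\frac{(2n)!}{n!\,m!}\,(1+x^2)^{\frac{n+m}{2}}\left(\frac{1}{1+x^2}-\frac{s^2}{\lambda^2}\right)^{-1/4}\left(1-\frac{s^2}{\lambda^2}\right)^{1/4}\left(\cos y+O\left(\frac{1}{n+m}\right)\right)$$ as $n\to\infty$, where $$y=\lambda\int_0^{\operatorname{arsinh}x}\sqrt{\frac{1}{\cosh^2\tau}-\frac{s^2}{\lambda^2}}\,d\tau.$$ The estimate of the remainder is uniform on any bounded set of $x$.
   Context: For integers $N\ge0$ and $s\ge0$, the polynomials $P_N^{(s)}(x)$ of degree $N$ are defined by $$P_N^{(s)}(x)=\sum_{k=0}^{[N/2]}(-1)^k\frac{N!\,(2x)^{N-2k}}{k!\,(N-2k)!\,(s+k)!},$$ where $[\cdot]$ is the integer part. *)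

theory Defs
  imports "HOL-Analysis.Analysis"
begin

definition P :: "nat \<Rightarrow> nat \<Rightarrow> real \<Rightarrow> real" where
  "P N s x = (\<Sum>k = 0..N div 2.
     (-1) ^ k * (fact N * (2 * x) ^ (N - 2 * k)) / (fact k * fact (N - 2 * k) * fact (s + k)))"

definition lam :: "nat \<Rightarrow> nat \<Rightarrow> real" where
  "lam n m = sqrt ((real n + real m)\<^sup>2 + real n + real m)"

text \<open>The ratio \<open>s / \<lambda>\<close> with \<open>s = m - n\<close>; the difference is taken in the reals.\<close>

definition ratio :: "nat \<Rightarrow> nat \<Rightarrow> real" where
  "ratio n m = (real m - real n) / lam n m"

text \<open>The interval integral is oriented, so negative \<open>x\<close> is covered as well.\<close>

definition phase :: "nat \<Rightarrow> nat \<Rightarrow> real \<Rightarrow> real" where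
  "phase n m x =
     lam n m * (LBINT \<tau>=0..arsinh x. sqrt (1 / (cosh \<tau>)\<^sup>2 - (ratio n m)\<^sup>2))"

end

theory Submission
  imports Defs
begin

text \<open>
  With \<open>x = sinh t\<close> and \<open>\<nu> = n + m\<close>, the function \<open>v(t) = (cosh t)\<^sup>-\<^sup>\<nu> P(sinh t)\<close> solves the
  Legendre-type equation \<open>v'' + \<lambda>\<^sup>2 q v = 0\<close>, where \<open>q(t) = 1 / cosh\<^sup>2 t - (s / \<lambda>)\<^sup>2\<close> stays away
  from \<open>0\<close> on bounded sets, and it is even because the degree \<open>2 n\<close> is. In the phase variable \<open>y\<close>
  the Liouville-Green transform \<open>w = q\<^sup>1\<^sup>/\<^sup>4 v\<close> obeys \<open>w'' + w = O(\<lambda>\<^sup>-\<^sup>2) w\<close>. The coordinates of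
  \<open>(w, w')\<close> in the frame rotating with \<open>y\<close> therefore drift by only \<open>O(\<lambda>\<^sup>-\<^sup>1)\<close> over the
  phase length \<open>O(\<lambda>)\<close>, so \<open>w = w(0) (cos y + O(1 / \<lambda>))\<close>.
\<close>

section \<open>Perturbed oscillators and the Liouville-Green transform\<close>

text \<open>For \<open>h = 0\<close> the pair \<open>(w, g)\<close> is a pure rotation by the angle
  \<open>y\<close>, starting from \<open>(w 0, 0)\<close>. The perturbation moves the rotating
  coordinates at speed at most \<open>M / L\<close> times the maximum of
  \<open>\<bar>w\<bar>\<close>, and \<open>small\<close> bounds that maximum by
  \<open>2 * \<bar>w 0\<bar>\<close>.\<close>

lemma perturbed_rotation:
  fixes w g y p h :: "real \<Rightarrow> real"
  assumes L: "0 < L" and T: "0 \<le> T" and M: "0 \<le> M" and small: "4 * M * T \<le> L"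
    and w: "\<And>t. \<bar>t\<bar> \<le> T \<Longrightarrow> (w has_real_derivative L * p t * g t) (at t)"
    and g: "\<And>t. \<bar>t\<bar> \<le> T \<Longrightarrow> (g has_real_derivative - L * p t * w t + h t / L * w t) (at t)"
    and y: "\<And>t. \<bar>t\<bar> \<le> T \<Longrightarrow> (y has_real_derivative L * p t) (at t)"
    and h: "\<And>t. \<bar>t\<bar> \<le> T \<Longrightarrow> \<bar>h t\<bar> \<le> M"
    and init: "g 0 = 0" "y 0 = 0"
    and t: "\<bar>t\<bar> \<le> T"
  shows "\<bar>w t - w 0 * cos (y t)\<bar> \<le> 4 * M * T / L * \<bar>w 0\<bar>"
proof -
  \<comment> \<open>coordinates of \<open>(w, g)\<close> in the frame rotating with \<open>y\<close>\<close>
  define a where "a t = w t * cos (y t) - g t * sin (y t)" for t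
  define b where "b t = w t * sin (y t) + g t * cos (y t)" for t
  \<comment> \<open>The terms with \<open>L * p\<close> cancel; only the perturbation drives
    \<open>a\<close> and \<open>b\<close>.\<close>
  have a': "(a has_real_derivative - (h t / L * w t * sin (y t))) (at t)" if "\<bar>t\<bar> \<le> T" for t
    unfolding a_def
    by (rule derivative_eq_intros w[OF that] g[OF that] y[OF that] refl)+ (simp add: algebra_simps)
  have b': "(b has_real_derivative h t / L * w t * cos (y t)) (at t)" if "\<bar>t\<bar> \<le> T" for t
    unfolding b_def
    by (rule derivative_eq_intros w[OF that] g[OF that] y[OF that] refl)+ (simp add: algebra_simps)
  have w_eq: "w t = a t * cos (y t) + b t * sin (y t)" for t
  proof -
    have "a t * cos (y t) + b t * sin (y t) = w t * ((sin (y t))\<^sup>2 + (cos (y t))\<^sup>2)"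
      unfolding a_def b_def by algebra
    then show ?thesis by simp
  qed
  have a0: "a 0 = w 0" and b0: "b 0 = 0"
    unfolding a_def b_def using init by simp_all
  have "continuous_on {-T..T} (\<lambda>t. \<bar>w t\<bar>)"
    by (intro continuous_on_rabs continuous_at_imp_continuous_on ballI)
       (auto intro!: DERIV_isCont w)
  then obtain t1 where t1: "\<bar>t1\<bar> \<le> T" and max: "\<And>t. \<bar>t\<bar> \<le> T \<Longrightarrow> \<bar>w t\<bar> \<le> \<bar>w t1\<bar>"
    using continuous_attains_sup[of "{-T..T}" "\<lambda>t. \<bar>w t\<bar>"] T
    by (force simp: abs_le_iff)
  define K where "K = M / L * \<bar>w t1\<bar>"
  have K: "0 \<le> K" using M L by (simp add: K_def)
  have coeff: "\<bar>h t / L * w t * c\<bar> \<le> K" if "\<bar>t\<bar> \<le> T" "\<bar>c\<bar> \<le> 1" for t c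
  proof -
    have "\<bar>h t / L * w t * c\<bar> = \<bar>h t\<bar> / L * \<bar>w t\<bar> * \<bar>c\<bar>"
      using L by (simp add: abs_mult)
    also have "\<dots> \<le> M / L * \<bar>w t1\<bar> * 1"
      using L h[OF that(1)] max[OF that(1)] that(2) M
      by (intro mult_mono divide_right_mono) auto
    finally show ?thesis by (simp add: K_def)
  qed
  have drift: "\<bar>a t - w 0\<bar> \<le> K * T" "\<bar>b t\<bar> \<le> K * T" if "\<bar>t\<bar> \<le> T" for t
  proof -
    have mem: "t \<in> {-T..T}" "0 \<in> {-T..T}" using that T by auto
    have "norm (a t - a 0) \<le> K * norm (t - 0)"
      using mem
      by (intro field_differentiable_bound[of "{-T..T}" a "\<lambda>t. - (h t / L * w t * sin (y t))"])
         (auto intro!: has_field_derivative_at_within[OF a'] coeff simp del: times_divide_eq_left)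
    also have "\<dots> \<le> K * T" using K that by (simp add: mult_left_mono)
    finally show "\<bar>a t - w 0\<bar> \<le> K * T" by (simp add: a0)
    have "norm (b t - b 0) \<le> K * norm (t - 0)"
      using mem
      by (intro field_differentiable_bound[of "{-T..T}" b "\<lambda>t. h t / L * w t * cos (y t)"])
         (auto intro!: has_field_derivative_at_within[OF b'] coeff simp del: times_divide_eq_left)
    also have "\<dots> \<le> K * T" using K that by (simp add: mult_left_mono)
    finally show "\<bar>b t\<bar> \<le> K * T" by (simp add: b0)
  qed
  have dev: "\<bar>w t - w 0 * cos (y t)\<bar> \<le> 2 * K * T" if "\<bar>t\<bar> \<le> T" for t
  proof -
    have "w t - w 0 * cos (y t) = (a t - w 0) * cos (y t) + b t * sin (y t)"
      by (subst w_eq) (simp add: algebra_simps)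
    also have "\<bar>\<dots>\<bar> \<le> \<bar>a t - w 0\<bar> * \<bar>cos (y t)\<bar> + \<bar>b t\<bar> * \<bar>sin (y t)\<bar>"
      by (metis abs_mult abs_triangle_ineq)
    also have "\<dots> \<le> \<bar>a t - w 0\<bar> * 1 + \<bar>b t\<bar> * 1"
      by (intro add_mono mult_left_mono) auto
    also have "\<dots> \<le> 2 * K * T" using drift[OF that] by simp
    finally show ?thesis .
  qed
  have "\<bar>w 0 * cos (y t1)\<bar> \<le> \<bar>w 0\<bar> * 1"
    unfolding abs_mult by (intro mult_left_mono) auto
  then have "\<bar>w t1\<bar> \<le> \<bar>w 0\<bar> + 2 * K * T" using dev[OF t1] by linarith
  \<comment> \<open>\<open>K\<close> contains \<open>\<bar>w t1\<bar>\<close> itself; by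
    \<open>small\<close> the deviation is at most half of it and can be absorbed.\<close>
  moreover have "2 * K * T \<le> \<bar>w t1\<bar> / 2"
  proof -
    have "2 * K * T = (4 * M * T / L) * \<bar>w t1\<bar> / 2" by (simp add: K_def)
    also have "\<dots> \<le> 1 * \<bar>w t1\<bar> / 2"
      using small L by (intro divide_right_mono mult_right_mono) auto
    finally show ?thesis by simp
  qed
  ultimately have "\<bar>w t1\<bar> \<le> 2 * \<bar>w 0\<bar>" by simp
  then have "2 * K * T \<le> 2 * (M / L * (2 * \<bar>w 0\<bar>)) * T"
    unfolding K_def using M L T by (intro mult_right_mono mult_left_mono) auto
  also have "\<dots> = 4 * M * T / L * \<bar>w 0\<bar>" by simp
  finally show ?thesis using dev[OF t] by linarith
qed

text \<open>In the phase \<open>y\<close>, \<open>w = q powr (1 / 4) * v\<close> has derivative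
  \<open>g\<close>, and \<open>dg/dy = - w + h * w / (L\<^sup>2 * sqrt q)\<close>, so
  \<open>perturbed_rotation\<close> applies with \<open>p = sqrt q\<close>. The conditions
  \<open>v' 0 = 0\<close> and \<open>q' 0 = 0\<close> give \<open>g 0 = 0\<close>. The lower bound
  is a fourth power so that \<open>\<delta>\<close> bounds the root \<open>s\<close> itself.\<close>

lemma Liouville_Green:
  fixes v v' q q' q'' y :: "real \<Rightarrow> real"
  assumes L: "0 < L" and T: "0 \<le> T" and \<delta>: "0 < \<delta>"
    and v: "\<And>t. \<bar>t\<bar> \<le> T \<Longrightarrow> (v has_real_derivative v' t) (at t)"
    and v': "\<And>t. \<bar>t\<bar> \<le> T \<Longrightarrow> (v' has_real_derivative - L\<^sup>2 * q t * v t) (at t)"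
    and q: "\<And>t. \<bar>t\<bar> \<le> T \<Longrightarrow> (q has_real_derivative q' t) (at t)"
    and q': "\<And>t. \<bar>t\<bar> \<le> T \<Longrightarrow> (q' has_real_derivative q'' t) (at t)"
    and y: "\<And>t. \<bar>t\<bar> \<le> T \<Longrightarrow> (y has_real_derivative L * sqrt (q t)) (at t)"
    and q_ge: "\<And>t. \<bar>t\<bar> \<le> T \<Longrightarrow> \<delta> ^ 4 \<le> q t"
    and q'_le: "\<And>t. \<bar>t\<bar> \<le> T \<Longrightarrow> \<bar>q' t\<bar> \<le> A"
    and q''_le: "\<And>t. \<bar>t\<bar> \<le> T \<Longrightarrow> \<bar>q'' t\<bar> \<le> A'"
    and init: "v' 0 = 0" "q' 0 = 0" "y 0 = 0"
    and M: "M = A' / (4 * \<delta> ^ 6) + 5 * A\<^sup>2 / (16 * \<delta> ^ 10)"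
    and small: "4 * M * T \<le> L"
    and t: "\<bar>t\<bar> \<le> T"
  shows "\<bar>q t powr (1 / 4) * v t - q 0 powr (1 / 4) * v 0 * cos (y t)\<bar>
    \<le> 4 * M * T / L * \<bar>q 0 powr (1 / 4) * v 0\<bar>"
proof -
  define s where "s t = q t powr (1 / 4)" for t
  \<comment> \<open>\<open>g\<close> is the derivative of \<open>w = s v\<close> with respect to the phase \<open>y\<close>\<close>
  define g where "g t = (v' t / s t + q' t * v t / (4 * s t ^ 5)) / L" for t
  define h where "h t = q'' t / (4 * s t ^ 6) - 5 * (q' t)\<^sup>2 / (16 * s t ^ 10)" for t
  have q_pos: "0 < q t" if "\<bar>t\<bar> \<le> T" for t
    using q_ge[OF that] \<delta> by (meson less_le_trans zero_less_power)
  have s_pos: "0 < s t" if "\<bar>t\<bar> \<le> T" for t using q_pos[OF that] by (simp add: s_def)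
  have s4: "s t ^ 4 = q t" if "\<bar>t\<bar> \<le> T" for t
    using q_pos[OF that] by (simp add: s_def powr_power)
  have s_ge: "\<delta> \<le> s t" if "\<bar>t\<bar> \<le> T" for t
    using q_ge[OF that] s_pos[OF that] \<delta> by (simp flip: s4[OF that])
  have s2: "sqrt (q t) = (s t)\<^sup>2" if "\<bar>t\<bar> \<le> T" for t
    by (rule real_sqrt_unique) (simp_all flip: s4[OF that])
  have s': "(s has_real_derivative q' t / (4 * s t ^ 3)) (at t)" if "\<bar>t\<bar> \<le> T" for t
  proof -
    have "(s has_real_derivative s t * (1 / 4 * q' t / q t)) (at t)"
      unfolding s_def using q_pos[OF that] powr_diff[of "q t" "1 / 4" 1]
      by (auto intro!: derivative_eq_intros q[OF that])
    moreover have "s t * (1 / 4 * q' t / q t) = q' t / (4 * s t ^ 3)"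
      using s_pos[OF that] unfolding s4[OF that, symmetric]
      by (simp add: field_simps power_numeral_reduce)
    ultimately show ?thesis by simp
  qed
  have w: "((\<lambda>t. s t * v t) has_real_derivative L * (s t)\<^sup>2 * g t) (at t)" if "\<bar>t\<bar> \<le> T" for t
  proof (rule DERIV_cong[OF DERIV_mult[OF s'[OF that] v[OF that]]])
    \<comment> \<open>With the reciprocal as a variable, the claim becomes a polynomial identity
      modulo \<open>i * s t = 1\<close>.\<close>
    define i where "i = 1 / s t"
    have "i * s t = 1" using s_pos[OF that] by (simp add: i_def)
    then have "q' t * i ^ 3 / 4 * v t + v' t * s t = (s t)\<^sup>2 * (v' t * i + q' t * v t * i ^ 5 / 4)"
      by algebra
    then show "q' t / (4 * s t ^ 3) * v t + v' t * s t = L * (s t)\<^sup>2 * g t"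
      using L by (simp add: g_def i_def power_one_over mult_ac)
  qed
  have g': "(g has_real_derivative - L * (s t)\<^sup>2 * (s t * v t) + h t / L * (s t * v t)) (at t)"
    if "\<bar>t\<bar> \<le> T" for t
  proof -
    define i where "i t = 1 / s t" for t
    have i': "(i has_real_derivative - (q' t * i t ^ 5 / 4)) (at t)"
      unfolding i_def using s_pos[OF that]
      by (auto intro!: derivative_eq_intros s'[OF that] simp: field_simps power_numeral_reduce)
    have g_i: "g = (\<lambda>t. (v' t * i t + q' t * v t * i t ^ 5 / 4) / L)"
      by (simp add: fun_eq_iff g_def i_def power_one_over)
    have h_i: "h t = q'' t * i t ^ 6 / 4 - 5 * (q' t)\<^sup>2 * i t ^ 10 / 16"
      by (simp add: h_def i_def power_one_over)
    have "((\<lambda>t. v' t * i t + q' t * v t * i t ^ 5 / 4) has_real_derivative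
      (- L\<^sup>2 * q t * v t) * i t + v' t * - (q' t * i t ^ 5 / 4)
        + (q'' t * v t * i t ^ 5 + q' t * v' t * i t ^ 5
           + q' t * v t * (5 * i t ^ 4 * - (q' t * i t ^ 5 / 4))) / 4) (at t)"
      by (auto intro!: derivative_eq_intros v[OF that] v'[OF that] q'[OF that] i'
          simp: algebra_simps add_divide_distrib diff_divide_distrib)
    from DERIV_cdivide[OF this, of L] have "(g has_real_derivative
      ((- L\<^sup>2 * q t * v t) * i t + v' t * - (q' t * i t ^ 5 / 4)
        + (q'' t * v t * i t ^ 5 + q' t * v' t * i t ^ 5
           + q' t * v t * (5 * i t ^ 4 * - (q' t * i t ^ 5 / 4))) / 4) / L) (at t)"
      unfolding g_i .
    \<comment> \<open>The two terms with \<open>v' t\<close> cancel, which is why the exponent is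
      \<open>1 / 4\<close>; \<open>h\<close> collects the part of the rest without
      \<open>L\<close>.\<close>
    moreover have "(- L\<^sup>2 * q t * v t) * i t + v' t * - (q' t * i t ^ 5 / 4)
        + (q'' t * v t * i t ^ 5 + q' t * v' t * i t ^ 5
           + q' t * v t * (5 * i t ^ 4 * - (q' t * i t ^ 5 / 4))) / 4
      = L * (- L * (s t)\<^sup>2 * (s t * v t)) + h t * (s t * v t)"
    proof -
      have pow: "s t ^ 4 * i t = s t ^ 3" "i t ^ 6 * s t = i t ^ 5" "i t ^ 10 * s t = i t ^ 9"
        using s_pos[OF that] by (simp_all add: i_def field_simps power_numeral_reduce)
      have q_i: "(- L\<^sup>2 * q t * v t) * i t = - L\<^sup>2 * (s t ^ 4 * i t) * v t"
        by (simp add: s4[OF that])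
      have h_s: "h t * (s t * v t) = (q'' t * (i t ^ 6 * s t) / 4
          - 5 * (q' t)\<^sup>2 * (i t ^ 10 * s t) / 16) * v t"
        unfolding h_i by (simp add: algebra_simps)
      show ?thesis
        unfolding q_i h_s pow by (simp add: field_simps power_numeral_reduce)
    qed
    ultimately have "(g has_real_derivative
        (L * (- L * (s t)\<^sup>2 * (s t * v t)) + h t * (s t * v t)) / L) (at t)"
      by (simp only:)
    then show ?thesis using L by (simp add: add_divide_distrib diff_divide_distrib)
  qed
  have h_le: "\<bar>h t\<bar> \<le> M" if "\<bar>t\<bar> \<le> T" for t
  proof -
    have "\<bar>h t\<bar> \<le> \<bar>q'' t / (4 * s t ^ 6)\<bar> + \<bar>5 * (q' t)\<^sup>2 / (16 * s t ^ 10)\<bar>"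
      unfolding h_def by (rule abs_triangle_ineq4)
    also have "\<dots> = \<bar>q'' t\<bar> / (4 * s t ^ 6) + 5 * \<bar>q' t\<bar>\<^sup>2 / (16 * s t ^ 10)"
      using s_pos[OF that] by (simp add: abs_mult)
    also have "\<dots> \<le> M"
      unfolding M using q''_le[OF that] q'_le[OF that] s_ge[OF that] \<delta>
      by (intro add_mono frac_le mult_left_mono power_mono mult_nonneg_nonneg) auto
    finally show ?thesis .
  qed
  have "0 \<le> M" using h_le[OF t] by linarith
  from perturbed_rotation[where w = "\<lambda>t. s t * v t" and p = "\<lambda>t. (s t)\<^sup>2" and g = g and h = h
      and y = y, OF L T this small w g' _ h_le _ init(3) t] y s2 init
  show ?thesis by (simp add: g_def s_def)
qed

section \<open>The differential equation of the polynomials\<close>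

definition P_coeff :: "nat \<Rightarrow> nat \<Rightarrow> nat \<Rightarrow> real" where
  "P_coeff N s k = (-1) ^ k * fact N * 2 ^ (N - 2 * k) / (fact k * fact (N - 2 * k) * fact (s + k))"

text \<open>At \<open>N = 2 * k\<close> the truncated exponent is 0 instead of -1, but the factor
  \<open>real (N - 2 * k)\<close> removes the term.\<close>

definition P' :: "nat \<Rightarrow> nat \<Rightarrow> real \<Rightarrow> real" where
  "P' N s x = (\<Sum>k = 0..N div 2. P_coeff N s k * (real (N - 2 * k) * x ^ (N - 2 * k - 1)))"

definition P'' :: "nat \<Rightarrow> nat \<Rightarrow> real \<Rightarrow> real" where
  "P'' N s x = (\<Sum>k = 0..N div 2. P_coeff N s k *
     (real (N - 2 * k) * (real (N - 2 * k - 1) * x ^ (N - 2 * k - 2))))"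

lemma P_eq: "P N s x = (\<Sum>k = 0..N div 2. P_coeff N s k * x ^ (N - 2 * k))"
  unfolding P_def P_coeff_def by (intro sum.cong refl) (simp add: power_mult_distrib)

lemma has_derivative_P: "(P N s has_real_derivative P' N s x) (at x)"
  unfolding P_eq[abs_def] P'_def
  by (auto intro!: derivative_eq_intros sum.cong)

lemma has_derivative_P': "(P' N s has_real_derivative P'' N s x) (at x)"
  unfolding P'_def[abs_def] P''_def
  by (auto intro!: derivative_eq_intros sum.cong simp: numeral_2_eq_2)

lemma P_coeff_Suc:
  assumes "2 * k + 2 \<le> N"
  shows "4 * real (Suc k) * real (Suc k + s) * P_coeff N s (Suc k) =
    - real (N - 2 * k) * real (N - 2 * k - 1) * P_coeff N s k"
proof -
  obtain j where N: "N = 2 * k + 2 + j" using assms le_Suc_ex by blast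
  show ?thesis
    unfolding P_coeff_def N by (simp add: divide_simps) (simp add: algebra_simps)
qed

text \<open>This is the Gegenbauer equation of degree \<open>N\<close> and parameter
  \<open>- (N + s)\<close> at imaginary argument. The degree-preserving terms multiply the monomial
  of degree \<open>j = N - 2 * k\<close> by
  \<open>(N - j) * (N - j + 2 * s) = 4 * k * (k + s)\<close>; the remaining \<open>P''\<close>
  lowers the degree by two, and \<open>P_coeff_Suc\<close> makes the two effects cancel.\<close>

lemma P_ode:
  "(1 + x\<^sup>2) * P'' N s x + (1 - 2 * (real N + real s)) * x * P' N s x
     + ((real N + real s)\<^sup>2 - (real s)\<^sup>2) * P N s x = 0"
proof -
  \<comment> \<open>by the coefficient recursion the left-hand side telescopes to differences of \<open>G\<close>\<close>
  define G where "G k = (if 2 * k \<le> N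
    then 4 * real k * real (k + s) * P_coeff N s k * x ^ (N - 2 * k) else 0)" for k
  have summand: "(1 + x\<^sup>2) * (P_coeff N s k *
       (real (N - 2 * k) * (real (N - 2 * k - 1) * x ^ (N - 2 * k - 2))))
     + (1 - 2 * (real N + real s)) * x * (P_coeff N s k * (real (N - 2 * k) * x ^ (N - 2 * k - 1)))
     + ((real N + real s)\<^sup>2 - (real s)\<^sup>2) * (P_coeff N s k * x ^ (N - 2 * k)) = G k - G (Suc k)"
    if k: "k \<le> N div 2" for k
  proof -
    have k': "2 * k \<le> N" using k by simp
    define j where "j = N - 2 * k"
    have N: "N = 2 * k + j" using k' by (simp add: j_def)
    \<comment> \<open>For \<open>j < 2\<close> the second derivative of the monomial vanishes, and
      so does \<open>G (Suc k)\<close> by its \<open>else\<close> branch.\<close>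
    consider "j = 0" | "j = 1" | i where "j = i + 2"
      by (metis One_nat_def Suc_eq_plus1 add_2_eq_Suc' not0_implies_Suc)
    then show ?thesis
    proof cases
      case 3
      have "G (Suc k) = (4 * real (Suc k) * real (Suc k + s) * P_coeff N s (Suc k)) * x ^ i"
        by (simp add: G_def N 3)
      also have "\<dots> = - real (i + 2) * real (i + 1) * P_coeff N s k * x ^ i"
        by (subst P_coeff_Suc) (simp_all add: N 3)
      finally have "G (Suc k) = - real (i + 2) * real (i + 1) * P_coeff N s k * x ^ i" .
      then show ?thesis
        by (simp add: G_def[of k] N 3) (simp add: algebra_simps power2_eq_square)
    qed (simp_all add: G_def N, simp_all add: algebra_simps power2_eq_square)
  qed
  have "(1 + x\<^sup>2) * P'' N s x + (1 - 2 * (real N + real s)) * x * P' N s x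
     + ((real N + real s)\<^sup>2 - (real s)\<^sup>2) * P N s x = (\<Sum>k = 0..N div 2. G k - G (Suc k))"
    unfolding P_eq P'_def P''_def sum_distrib_left sum.distrib[symmetric]
    by (intro sum.cong refl summand) simp
  also have "\<dots> = G 0 - G (Suc (N div 2))"
    using sum_telescope[of G "N div 2"] by (simp add: atLeast0AtMost)
  \<comment> \<open>\<open>G 0\<close> vanishes by its factor \<open>k\<close>, the other end
    because \<open>2 * Suc (N div 2)\<close> exceeds \<open>N\<close>.\<close>
  also have "\<dots> = 0" by (simp add: G_def)
  finally show ?thesis .
qed

text \<open>Only \<open>k = n\<close> contributes at 0. For \<open>s = m - n\<close> with
  \<open>n \<le> m\<close> this is the prefactor of the expansion.\<close>

lemma P_even_0: "P (2 * n) s 0 = (-1) ^ n * (fact (2 * n) / (fact n * fact (s + n)))"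
proof -
  have "P (2 * n) s 0 = (\<Sum>k = 0..n. if k = n then P_coeff (2 * n) s n else 0)"
    unfolding P_eq by (intro sum.cong) (auto simp: power_0_left)
  then show ?thesis by (simp add: P_coeff_def)
qed

lemma P'_even_0: "P' (2 * n) s 0 = 0"
  unfolding P'_def by (intro sum.neutral) (auto simp: power_0_left)

section \<open>Reduction to an equation without first-order term\<close>

text \<open>For \<open>f t = P N s (sinh t)\<close>, \<open>P_ode\<close> reads \<open>f'' - 2 *
  \<nu> * tanh t * f' + (\<nu>\<^sup>2 - s\<^sup>2) * f = 0\<close>, and the weight
  \<open>cosh t powr - \<nu>\<close> removes the middle term. For \<open>\<nu> = n + m\<close> the
  constant \<open>\<nu> * (\<nu> + 1)\<close> is the square of \<open>lam n m\<close>.\<close>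

lemma
  fixes \<nu> :: real
  assumes \<nu>: "\<nu> = real N + real s"
  defines "U \<equiv> \<lambda>t. cosh t powr - \<nu> * P N s (sinh t)"
    and "U' \<equiv> \<lambda>t. cosh t powr - \<nu> * (cosh t * P' N s (sinh t) - \<nu> * (sinh t / cosh t) * P N s (sinh t))"
  shows has_derivative_cosh_powr_P: "(U has_real_derivative U' t) (at t)"
    and cosh_powr_P_ode:
      "(U' has_real_derivative ((real s)\<^sup>2 - \<nu> * (\<nu> + 1) / (cosh t)\<^sup>2) * U t) (at t)"
proof -
  define E where "E t = cosh t powr - \<nu>" for t :: real
  define h where "h t = sinh t / cosh t" for t :: real
  note dP = DERIV_chain2[OF has_derivative_P] DERIV_chain2[OF has_derivative_P']
  have E: "(E has_real_derivative - \<nu> * E t * h t) (at t)" for t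
    unfolding E_def h_def by (auto intro!: derivative_eq_intros simp: powr_diff)
  have h: "(h has_real_derivative 1 / (cosh t)\<^sup>2) (at t)" for t
    unfolding h_def
    by (auto intro!: derivative_eq_intros simp: cosh_square_eq power2_eq_square[symmetric])
  show "(U has_real_derivative U' t) (at t)"
    unfolding U_def U'_def E_def[symmetric] h_def[symmetric]
    by (auto intro!: derivative_eq_intros E dP simp: algebra_simps)
  define i where "i = 1 / cosh t"
  have i: "i * cosh t = 1" by (simp add: i_def)
  have h_i: "h t = sinh t * i" by (simp add: h_def i_def)
  have "(U' has_real_derivative
      - \<nu> * E t * h t * (cosh t * P' N s (sinh t) - \<nu> * h t * P N s (sinh t))
      + E t * (sinh t * P' N s (sinh t) + cosh t * (P'' N s (sinh t) * cosh t)
        - \<nu> * (1 / (cosh t)\<^sup>2 * P N s (sinh t) + h t * (P' N s (sinh t) * cosh t)))) (at t)"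
    unfolding U'_def E_def[symmetric] h_def[symmetric]
    by (auto intro!: derivative_eq_intros E dP h simp: algebra_simps)
  moreover have "- \<nu> * E t * h t * (cosh t * P' N s (sinh t) - \<nu> * h t * P N s (sinh t))
      + E t * (sinh t * P' N s (sinh t) + cosh t * (P'' N s (sinh t) * cosh t)
        - \<nu> * (i\<^sup>2 * P N s (sinh t) + h t * (P' N s (sinh t) * cosh t)))
     = ((real s)\<^sup>2 - \<nu> * (\<nu> + 1) * i\<^sup>2) * (E t * P N s (sinh t))"
    using P_ode[of "sinh t" N s] i cosh_square_eq[of t] unfolding h_i \<nu>[symmetric] by algebra
  ultimately show "(U' has_real_derivative ((real s)\<^sup>2 - \<nu> * (\<nu> + 1) / (cosh t)\<^sup>2) * U t) (at t)"
    by (simp add: U_def E_def i_def power_one_over)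
qed

section \<open>The phase function and the estimate on bounded sets\<close>

lemma has_derivative_interval_integral:
  fixes f :: "real \<Rightarrow> real"
  assumes "continuous_on UNIV f"
  shows "((\<lambda>t. LBINT \<tau>=0..t. f \<tau>) has_real_derivative f t) (at t)"
proof -
  \<comment> \<open>The window contains 0 and has \<open>t\<close> in its interior, so both signs of
    \<open>t\<close> are covered and the derivative within it is the full one.\<close>
  define a where "a = - \<bar>t\<bar> - 1"
  define b where "b = \<bar>t\<bar> + 1"
  have ab: "a \<le> 0" "0 \<le> b" "t \<in> {a<..<b}" by (auto simp: a_def b_def)
  have "((\<lambda>u. LBINT \<tau>=ereal 0..u. f \<tau>) has_vector_derivative f t) (at t within {a..b})"
    using ab by (intro interval_integral_FTC2 continuous_on_subset[OF assms]) auto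
  moreover have "at t within {a..b} = at t"
    using ab by (intro at_within_interior) auto
  ultimately show ?thesis
    by (simp add: has_real_derivative_iff_has_vector_derivative zero_ereal_def)
qed

lemma abs_sinh_le_cosh: "\<bar>sinh x\<bar> \<le> cosh (x :: real)"
  by (rule abs_le_square_iff[THEN iffD2, of "sinh x" "cosh x", simplified])
     (simp add: cosh_square_eq)

text \<open>The estimate for a single pair \<open>n\<close>, \<open>m\<close>, with \<open>M\<close>
  and \<open>T\<close> depending on \<open>b\<close> and \<open>d\<close> alone; this yields
  uniformity. In \<open>M\<close>, 8 and 2 bound the derivatives of \<open>q\<close>;
  \<open>T\<close> bounds \<open>\<bar>arsinh x\<bar>\<close>.\<close>

lemma P_Liouville_Green:
  fixes b d M T x :: real
  assumes n: "1 \<le> n" "n \<le> m"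
    and d: "0 < d" "2 * d ^ 4 * (1 + b\<^sup>2) \<le> 1"
    and r: "(ratio n m)\<^sup>2 \<le> d ^ 4"
    and M: "M = 8 / (4 * d ^ 6) + 5 * 2\<^sup>2 / (16 * d ^ 10)"
    and T: "T = arsinh b"
    and small: "4 * M * T \<le> real n + real m"
    and x: "\<bar>x\<bar> \<le> b"
  shows "0 < 1 / (1 + x\<^sup>2) - (ratio n m)\<^sup>2 \<and>
    (\<exists>\<epsilon>. \<bar>\<epsilon>\<bar> \<le> 4 * M * T / (real n + real m) \<and>
      P (2 * n) (m - n) x =
        (-1) ^ n * (fact (2 * n) / (fact n * fact m))
        * (1 + x\<^sup>2) powr ((real n + real m) / 2)
        * (1 / (1 + x\<^sup>2) - (ratio n m)\<^sup>2) powr (- (1 / 4))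
        * (1 - (ratio n m)\<^sup>2) powr (1 / 4)
        * (cos (phase n m x) + \<epsilon>))"
proof -
  define \<nu> where "\<nu> = real n + real m"
  define s where "s = m - n"
  define L where "L = lam n m"
  define r where "r = ratio n m"
  define v where "v t = cosh t powr - \<nu> * P (2 * n) s (sinh t)" for t
  define v' where "v' t = cosh t powr - \<nu> *
    (cosh t * P' (2 * n) s (sinh t) - \<nu> * (sinh t / cosh t) * P (2 * n) s (sinh t))" for t
  define q where "q t = 1 / (cosh t)\<^sup>2 - r\<^sup>2" for t :: real
  define q' where "q' t = - 2 * sinh t / cosh t ^ 3" for t :: real
  define q'' where "q'' t = 6 * (sinh t)\<^sup>2 / cosh t ^ 4 - 2 / (cosh t)\<^sup>2" for t :: real
  define y where "y t = L * (LBINT \<tau>=0..t. sqrt (q \<tau>))" for t :: real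
  have \<nu>_pos: "0 < \<nu>" using n by (simp add: \<nu>_def)
  have \<nu>: "\<nu> = real (2 * n) + real s" using n by (simp add: \<nu>_def s_def of_nat_diff)
  have L2: "L\<^sup>2 = \<nu> * (\<nu> + 1)"
    using \<nu>_pos unfolding L_def lam_def \<nu>_def
    by (subst real_sqrt_pow2) (auto simp: algebra_simps power2_eq_square)
  have "\<nu> \<le> L"
    unfolding L_def lam_def \<nu>_def by (intro real_le_rsqrt) auto
  then have L_pos: "0 < L" using \<nu>_pos by linarith
  \<comment> \<open>Hence \<open>L\<^sup>2 * r\<^sup>2 = s\<^sup>2\<close>, which makes
    \<open>- L\<^sup>2 * q\<close> the coefficient in \<open>cosh_powr_P_ode\<close>.\<close>
  have Lr: "L * r = real s"
    using L_pos n by (simp add: r_def ratio_def s_def of_nat_diff flip: L_def)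
  have b: "0 \<le> b" using x by linarith
  then have T_nonneg: "0 \<le> T" unfolding T by (metis arsinh_real_neg_iff not_less)
  have cosh_le: "(cosh t)\<^sup>2 \<le> 1 + b\<^sup>2" if "\<bar>t\<bar> \<le> T" for t
  proof -
    have "cosh \<bar>t\<bar> \<le> cosh T"
      using that T_nonneg by (subst cosh_real_nonneg_le_iff) auto
    then have "cosh t \<le> cosh T" by (simp add: abs_if split: if_splits)
    then have "(cosh t)\<^sup>2 \<le> (cosh T)\<^sup>2" by (intro power_mono) auto
    then show ?thesis by (simp add: T cosh_arsinh_real add.commute)
  qed
  have v: "(v has_real_derivative v' t) (at t)" for t
    using has_derivative_cosh_powr_P[OF \<nu>, of t] by (simp add: v_def[abs_def] v'_def[abs_def])
  have v': "(v' has_real_derivative - L\<^sup>2 * q t * v t) (at t)" for t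
  proof -
    have "- L\<^sup>2 * q t = (real s)\<^sup>2 - \<nu> * (\<nu> + 1) / (cosh t)\<^sup>2"
      unfolding q_def Lr[symmetric] L2[symmetric] power_mult_distrib by (simp add: right_diff_distrib)
    then show ?thesis
      using cosh_powr_P_ode[OF \<nu>, of t] by (simp add: v_def[abs_def] v'_def[abs_def])
  qed
  have q: "(q has_real_derivative q' t) (at t)" for t
    unfolding q_def[abs_def] q'_def
    by (auto intro!: derivative_eq_intros simp: field_simps power_numeral_reduce)
  have q': "(q' has_real_derivative q'' t) (at t)" for t
    unfolding q'_def[abs_def] q''_def
    by (auto intro!: derivative_eq_intros simp: field_simps power_numeral_reduce)
  have cont: "continuous_on UNIV (\<lambda>t. sqrt (q t))"
    unfolding q_def by (intro continuous_intros) auto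
  have y: "(y has_real_derivative L * sqrt (q t)) (at t)" for t
    unfolding y_def[abs_def] by (intro DERIV_cmult has_derivative_interval_integral cont)
  \<comment> \<open>On this range \<open>1 / (cosh t)\<^sup>2\<close> is at least
    \<open>2 * d ^ 4\<close>; subtracting \<open>r\<^sup>2\<close> costs at most half of
    that.\<close>
  have q_ge: "d ^ 4 \<le> q t" if "\<bar>t\<bar> \<le> T" for t
  proof -
    have "2 * d ^ 4 \<le> 1 / (1 + b\<^sup>2)"
      using d by (simp add: pos_le_divide_eq add_pos_nonneg)
    also have "\<dots> \<le> 1 / (cosh t)\<^sup>2"
      using cosh_le[OF that] by (intro divide_left_mono) (auto intro!: mult_pos_pos add_pos_nonneg)
    finally show ?thesis using r by (simp add: q_def r_def)
  qed
  have cosh_inv: "1 / cosh t ^ k \<le> 1" for t :: real and k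
    by (simp add: cosh_real_ge_1)
  have q'_le: "\<bar>q' t\<bar> \<le> 2" for t
  proof -
    have "\<bar>q' t\<bar> = 2 * (\<bar>sinh t\<bar> / cosh t) * (1 / (cosh t)\<^sup>2)"
      by (simp add: q'_def abs_mult power_numeral_reduce)
    also have "\<dots> \<le> 2 * 1 * 1"
      using abs_sinh_le_cosh[of t] cosh_inv by (intro mult_mono) auto
    finally show ?thesis by simp
  qed
  have q''_le: "\<bar>q'' t\<bar> \<le> 8" for t
  proof -
    have "\<bar>q'' t\<bar> \<le> \<bar>6 * (sinh t)\<^sup>2 / cosh t ^ 4\<bar> + \<bar>2 / (cosh t)\<^sup>2\<bar>"
      unfolding q''_def by (rule abs_triangle_ineq4)
    also have "\<dots> = 6 * ((sinh t)\<^sup>2 / (cosh t)\<^sup>2) * (1 / (cosh t)\<^sup>2) + 2 * (1 / (cosh t)\<^sup>2)"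
      by (simp add: power_numeral_reduce)
    also have "\<dots> \<le> 6 * 1 * 1 + 2 * 1"
    proof -
      have "(sinh t)\<^sup>2 \<le> (cosh t)\<^sup>2" by (simp add: cosh_square_eq)
      then have "(sinh t)\<^sup>2 / (cosh t)\<^sup>2 \<le> 1" by simp
      then show ?thesis using cosh_inv[of t 2] by (intro add_mono mult_mono) simp_all
    qed
    finally show ?thesis by simp
  qed
  have init: "v' 0 = 0" "q' 0 = 0" "y 0 = 0"
    by (simp_all add: v'_def q'_def y_def P'_even_0 flip: zero_ereal_def)
  define t where "t = arsinh x"
  have sinh_t: "sinh t = x" by (simp add: t_def)
  have cosh_t: "cosh t = sqrt (1 + x\<^sup>2)" by (simp add: t_def cosh_arsinh_real add.commute)
  have q_t: "q t = 1 / (1 + x\<^sup>2) - r\<^sup>2" by (simp add: q_def cosh_t)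
  have y_t: "y t = phase n m x" by (simp add: y_def phase_def t_def q_def L_def r_def)
  have t: "\<bar>t\<bar> \<le> T"
  proof -
    have "arsinh x \<le> arsinh b" "arsinh (- x) \<le> arsinh b"
      using x by (simp_all add: not_less[symmetric] del: arsinh_minus_real)
    then show ?thesis by (simp add: t_def T abs_le_iff)
  qed
  have q_pos: "0 < q t" using q_ge[OF t] d by (meson less_le_trans zero_less_power)
  have M_nonneg: "0 \<le> M" using d by (simp add: M)
  define p where "p = (-1) ^ n * (fact (2 * n) / (fact n * fact m) :: real)"
  define w0 where "w0 = (1 - r\<^sup>2) powr (1 / 4) * p"
  have w0: "q 0 powr (1 / 4) * v 0 = w0"
    using n by (simp add: q_def v_def P_even_0 s_def p_def w0_def)
  have "0 < d ^ 4" using d by simp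
  also have "d ^ 4 \<le> q 0" using q_ge[of 0] T_nonneg by simp
  finally have "0 < 1 - r\<^sup>2" by (simp add: q_def)
  then have w0_nz: "w0 \<noteq> 0" by (simp add: w0_def p_def)
  \<comment> \<open>The error relative to the nonzero initial value \<open>w0\<close>; the bound in
    \<open>1 / L\<close> then passes to \<open>1 / \<nu>\<close> by
    \<open>\<nu> \<le> L\<close>.\<close>
  define \<epsilon> where "\<epsilon> = q t powr (1 / 4) * v t / w0 - cos (y t)"
  have "\<bar>w0 * \<epsilon>\<bar> \<le> 4 * M * T / L * \<bar>w0\<bar>"
    using Liouville_Green[where \<delta> = d and v = v and v' = v' and q = q and q' = q' and q'' = q''
        and y = y and A = 2 and A' = 8, OF L_pos T_nonneg d(1) v v' q q' y q_ge q'_le q''_le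
        init M _ t] small \<open>\<nu> \<le> L\<close> w0_nz
    by (simp add: w0 \<epsilon>_def right_diff_distrib \<nu>_def)
  then have "\<bar>\<epsilon>\<bar> \<le> 4 * M * T / L"
    using w0_nz by (simp add: abs_mult mult.commute[of "\<bar>w0\<bar>"] del: times_divide_eq_left)
  also have "\<dots> \<le> 4 * M * T / \<nu>"
    using \<open>\<nu> \<le> L\<close> \<nu>_pos M_nonneg T_nonneg L_pos by (intro divide_left_mono) auto
  finally have \<epsilon>: "\<bar>\<epsilon>\<bar> \<le> 4 * M * T / \<nu>" .
  have "v t = q t powr - (1 / 4) * (w0 * (cos (y t) + \<epsilon>))"
    using w0_nz q_pos by (simp add: \<epsilon>_def powr_minus)
  moreover have "P (2 * n) s x = cosh t powr \<nu> * v t"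
    by (simp add: v_def sinh_t powr_minus)
  moreover have "cosh t powr \<nu> = (1 + x\<^sup>2) powr (\<nu> / 2)"
    by (simp add: cosh_t powr_powr add_nonneg_nonneg flip: powr_half_sqrt)
  ultimately have "P (2 * n) s x = p * (1 + x\<^sup>2) powr (\<nu> / 2) * q t powr - (1 / 4)
      * (1 - r\<^sup>2) powr (1 / 4) * (cos (y t) + \<epsilon>)"
    by (simp add: w0_def mult_ac)
  then show ?thesis
    using \<epsilon> q_pos unfolding q_t y_t \<nu>_def r_def s_def p_def by blast
qed

text \<open>The constant is \<open>4 * M * T\<close>, fixed by a bound \<open>b\<close> for the set.
  The positivity clause ensures that \<open>powr\<close> acts on a positive base and that the root
  in the phase is real along the whole integration path.\<close>

theorem theorem5p1:
  fixes m :: "nat \<Rightarrow> nat"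
  assumes "\<And>n. n \<le> m n"
    and "(\<lambda>n. ratio n (m n)) \<longlonglongrightarrow> 0"
  shows "\<forall>B :: real set. bounded B \<longrightarrow>
    (\<exists>C. \<forall>\<^sub>F n in sequentially. \<forall>x\<in>B.
       0 < 1 / (1 + x\<^sup>2) - (ratio n (m n))\<^sup>2 \<and>
       (\<exists>\<epsilon>. \<bar>\<epsilon>\<bar> \<le> C / (real n + real (m n)) \<and>
         P (2 * n) (m n - n) x =
           (-1) ^ n * (fact (2 * n) / (fact n * fact (m n)))
           * (1 + x\<^sup>2) powr ((real n + real (m n)) / 2)
           * (1 / (1 + x\<^sup>2) - (ratio n (m n))\<^sup>2) powr (- (1 / 4))
           * (1 - (ratio n (m n))\<^sup>2) powr (1 / 4)
           * (cos (phase n (m n) x) + \<epsilon>)))"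
proof (intro allI impI)
  fix B :: "real set"
  assume "bounded B"
  then obtain b where b: "\<And>x. x \<in> B \<Longrightarrow> \<bar>x\<bar> \<le> b"
    unfolding bounded_iff by auto
  \<comment> \<open>The fourth power of \<open>d\<close> is half the lower bound
    \<open>1 / (1 + b\<^sup>2)\<close> of \<open>1 / (1 + x\<^sup>2)\<close>; the other half leaves
    room for the squared ratio.\<close>
  define d where "d = (1 / (2 * (1 + b\<^sup>2))) powr (1 / 4)"
  have b2: "0 < 1 + b\<^sup>2" by (simp add: add_pos_nonneg)
  have d_pos: "0 < d" using b2 by (simp add: d_def)
  have d4: "d ^ 4 = 1 / (2 * (1 + b\<^sup>2))" using b2 by (simp add: d_def powr_power)
  have d: "2 * d ^ 4 * (1 + b\<^sup>2) \<le> 1" using b2 by (simp add: d4)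
  define M where "M = 8 / (4 * d ^ 6) + 5 * 2\<^sup>2 / (16 * d ^ 10)"
  define T where "T = arsinh b"
  have "(\<lambda>n. (ratio n (m n))\<^sup>2) \<longlonglongrightarrow> 0\<^sup>2"
    by (intro tendsto_power assms)
  then have "\<forall>\<^sub>F n in sequentially. (ratio n (m n))\<^sup>2 < d ^ 4"
    using d_pos by (intro order_tendstoD(2)[where y = 0]) auto
  moreover have "\<forall>\<^sub>F n in sequentially. 4 * M * T \<le> real n"
    by (rule filterlim_real_sequentially[unfolded filterlim_at_top, rule_format])
  ultimately have "\<forall>\<^sub>F n in sequentially. \<forall>x\<in>B.
       0 < 1 / (1 + x\<^sup>2) - (ratio n (m n))\<^sup>2 \<and>
       (\<exists>\<epsilon>. \<bar>\<epsilon>\<bar> \<le> 4 * M * T / (real n + real (m n)) \<and>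
         P (2 * n) (m n - n) x =
           (-1) ^ n * (fact (2 * n) / (fact n * fact (m n)))
           * (1 + x\<^sup>2) powr ((real n + real (m n)) / 2)
           * (1 / (1 + x\<^sup>2) - (ratio n (m n))\<^sup>2) powr (- (1 / 4))
           * (1 - (ratio n (m n))\<^sup>2) powr (1 / 4)
           * (cos (phase n (m n) x) + \<epsilon>))"
    using eventually_ge_at_top[of 1]
  proof eventually_elim
    case (elim n)
    then show ?case
      by (intro ballI P_Liouville_Green[OF _ assms(1) d_pos d _ M_def T_def _ b]) auto
  qed
  then show "\<exists>C. \<forall>\<^sub>F n in sequentially. \<forall>x\<in>B.
       0 < 1 / (1 + x\<^sup>2) - (ratio n (m n))\<^sup>2 \<and>
       (\<exists>\<epsilon>. \<bar>\<epsilon>\<bar> \<le> C / (real n + real (m n)) \<and>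
         P (2 * n) (m n - n) x =
           (-1) ^ n * (fact (2 * n) / (fact n * fact (m n)))
           * (1 + x\<^sup>2) powr ((real n + real (m n)) / 2)
           * (1 / (1 + x\<^sup>2) - (ratio n (m n))\<^sup>2) powr (- (1 / 4))
           * (1 - (ratio n (m n))\<^sup>2) powr (1 / 4)
           * (cos (phase n (m n) x) + \<epsilon>))"
    by blast
qed

end
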